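(* There exist universal constants $c_1',c_2'>0$ such that for every $n\ge1$, every $t\in\mathbb{R}$ and every $a\in\mathbb{R}^n$ with $a_1\ge a_2\ge\dots\ge a_n\ge0$ and $\sum_i a_i^2=1$, the halfspace $f:\{-1,1\}^n\to\{0,1\}$, $f(x)=\mathbf{1}\left(\sum_i a_ix_i>t\right)$, satisfies: if $\mathbb{E}[f]\le\frac12$, then $$c_1'\,\mathbb{E}[f]\min\left\{1,a_1\sqrt{\log(1/\mathbb{E}[f])}\right\}\;\le\;\frac{|\partial(\mathbf{1}_f)|}{2^n}\;\le\; c_2'\,\mathbb{E}[f]\min\left\{1,a_1\sqrt{\log(1/\mathbb{E}[f])}\right\}.$$
   Context: Expectations are with respect to the uniform measure on $\{-1,1\}^n$. $\mathbf{1}_f=\{x:f(x)=1\}$, and $\partial(\mathbf{1}_f)$ is its (inner) vertex boundary in the discrete cube graph, i.e. $\partial(\mathbf{1}_f)=\{x\in\{-1,1\}^n: f(x)=1 \text{ and } f(x\oplus e_i)=0 \text{ for some } i\}$, where $x\oplus e_i$ is $x$ with the $i$th coordinate flipped. $\log$ is the natural logarithm. If $\mathbb{E}[f]=0$, both bounding expressions are interpreted as $0$. *)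

theory Defs
  imports "HOL-Probability.Probability_Mass_Function"
begin

definition cube :: "nat \<Rightarrow> (nat \<Rightarrow> real) set" where
  "cube n = {1..n} \<rightarrow>\<^sub>E {-1, 1}"

definition cube_expectation :: "nat \<Rightarrow> ((nat \<Rightarrow> real) \<Rightarrow> real) \<Rightarrow> real" where
  "cube_expectation n f = measure_pmf.expectation (pmf_of_set (cube n)) f"

definition flip :: "(nat \<Rightarrow> real) \<Rightarrow> nat \<Rightarrow> nat \<Rightarrow> real" where
  "flip x i = x(i := - x i)"

definition halfspace :: "nat \<Rightarrow> (nat \<Rightarrow> real) \<Rightarrow> real \<Rightarrow> (nat \<Rightarrow> real) \<Rightarrow> real" where
  "halfspace n a t x = of_bool ((\<Sum>i=1..n. a i * x i) > t)"

text \<open>Inner vertex boundary of the set where \<open>f\<close> equals 1, for a 0/1-valued \<open>f\<close> on the cube.\<close>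

definition vertex_boundary :: "nat \<Rightarrow> ((nat \<Rightarrow> real) \<Rightarrow> real) \<Rightarrow> (nat \<Rightarrow> real) set" where
  "vertex_boundary n f = {x \<in> cube n. f x = 1 \<and> (\<exists>i\<in>{1..n}. f (flip x i) = 0)}"

text \<open>At \<open>p = 0\<close> this is 0 because of the factor \<open>p\<close>, whatever the value of \<open>ln (1 / 0)\<close>.\<close>

definition boundary_bound :: "real \<Rightarrow> real \<Rightarrow> real" where
  "boundary_bound \<alpha> p = p * min 1 (\<alpha> * sqrt (ln (1 / p)))"

lemma finite_cube: "finite (cube n)"
  by (simp add: cube_def finite_PiE)

lemma card_cube: "card (cube n) = 2 ^ n"
  by (simp add: cube_def card_PiE numeral_2_eq_2)

lemma cube_nonempty: "cube n \<noteq> {}"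
  by (simp add: cube_def PiE_eq_empty_iff)

lemma flip_in_cube: "x \<in> cube n \<Longrightarrow> i \<in> {1..n} \<Longrightarrow> flip x i \<in> cube n"
  by (fastforce simp: cube_def flip_def PiE_iff extensional_def)

lemma cube_expectation_eq_average: "cube_expectation n f = (\<Sum>x\<in>cube n. f x) / 2 ^ n"
  by (simp add: cube_expectation_def integral_pmf_of_set finite_cube cube_nonempty card_cube)

end

theory Submission
  imports Defs "HOL-Probability.Hoeffding"
begin

text \<open>
  Write \<open>X\<close> for the sum of all \<open>a\<^sub>i x\<^sub>i\<close>, \<open>p\<close> for the probability of \<open>X > t\<close> and \<open>\<alpha>\<close> for the largest
  coefficient. A point of the boundary satisfies \<open>t < X \<le> t + 2 \<alpha>\<close>, so the question is how much of the
  tail of \<open>X\<close> sits in a window of length comparable to \<open>\<alpha>\<close> right above \<open>t\<close>. For a Gaussian \<open>X\<close> the ratio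
  of density and tail is about \<open>sqrt (ln (1 / p))\<close>, which explains the formula.

  The comparison with the Gaussian is a discrete integration by parts (\<open>sum_rad_mult_eq\<close>): the mean of
  \<open>X G(X)\<close> equals half the sum over \<open>i\<close> of \<open>a\<^sub>i\<close> times the mean variation of \<open>G(X)\<close> under a flip of
  \<open>x\<^sub>i\<close>. If \<open>G\<close> varies at scale \<open>\<alpha>\<close> near the window, then this variation is of order \<open>a\<^sub>i / \<alpha>\<close> there. Since
  the \<open>a\<^sub>i\<^sup>2\<close> add up to 1, the mean of \<open>X G(X)\<close> is comparable to the mass of the window divided by \<open>\<alpha>\<close>.

  For the upper bound, \<open>G\<close> is a function supported above \<open>t\<close>, and the mean of \<open>X G(X)\<close> is at most a
  multiple of \<open>p sqrt (ln (1 / p))\<close>, because \<open>X\<close> is subgaussian (\<open>sum_rad_mult_le\<close>, \<open>card_window_le\<close>).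

  For the lower bound, \<open>t \<ge> 0\<close> may be assumed by symmetry. Unless the window from \<open>t\<close> to \<open>t + \<alpha>\<close>
  already carries half of the event \<open>X > t\<close>, the mean of \<open>X G(X)\<close>, for a ramp \<open>G\<close>, is
  at least about \<open>(t + \<alpha>) p\<close>, and the reverse Chernoff bound \<open>card_rad_gt_ge_exp\<close> shows that \<open>t + \<alpha>\<close> is at
  least a multiple of \<open>sqrt (ln (1 / p))\<close> or of \<open>1 / \<alpha>\<close>, except when \<open>t + \<alpha>\<close> is small, where it bounds
  the mean directly. This yields mass in the union of the boundary and a window of length \<open>\<alpha>\<close>
  (\<open>sum_rad_ramp_le\<close>). Not every point of this window is a boundary point, but those
  which are not can be mapped injectively into the boundary by a reflection
  (\<open>card_window_diff_inner_boundary_le\<close>).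
\<close>

section \<open>Rademacher sums and their moments\<close>

abbreviation (input) signs :: "'i set \<Rightarrow> ('i \<Rightarrow> real) set" where
  "signs I \<equiv> I \<rightarrow>\<^sub>E {-1, 1}"

abbreviation (input) rad :: "('i \<Rightarrow> real) \<Rightarrow> 'i set \<Rightarrow> ('i \<Rightarrow> real) \<Rightarrow> real" where
  "rad a I x \<equiv> (\<Sum>i\<in>I. a i * x i)"

lemma finite_signs [simp]: "finite I \<Longrightarrow> finite (signs I)"
  by (simp add: finite_PiE)

lemma card_signs: "finite I \<Longrightarrow> card (signs I) = 2 ^ card I"
  by (simp add: card_PiE numeral_2_eq_2)

lemma sum_signs_insert:
  assumes "finite I" "i \<notin> I"
  shows "(\<Sum>x\<in>signs (insert i I). h x) = (\<Sum>y\<in>signs I. h (y(i := 1)) + h (y(i := - 1)))"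
proof -
  have "inj_on (\<lambda>(y, g). g(i := y)) ({- 1, 1 :: real} \<times> signs I)"
    using assms(2) by (rule inj_combinator)
  then have "(\<Sum>x\<in>signs (insert i I). h x) = (\<Sum>(v, y)\<in>{- 1, 1} \<times> signs I. h (y(i := v)))"
    unfolding PiE_insert_eq by (subst sum.reindex) (auto simp: case_prod_beta intro: sum.cong)
  also have "\<dots> = (\<Sum>v\<in>{-1, 1}. \<Sum>y\<in>signs I. h (y(i := v)))"
    by (rule sum.cartesian_product[symmetric])
  finally show ?thesis
    by (simp add: sum.distrib add.commute)
qed

lemma rad_insert:
  assumes "finite I" "i \<notin> I"
  shows "rad a (insert i I) (y(i := v)) = rad a I y + a i * v"
proof -
  have "(\<Sum>j\<in>I. a j * (y(i := v)) j) = rad a I y"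
    using assms by (intro sum.cong) auto
  then show ?thesis
    using assms by simp
qed

lemma sum_rad_square:
  assumes "finite I"
  shows "(\<Sum>x\<in>signs I. (rad a I x)\<^sup>2) = 2 ^ card I * (\<Sum>i\<in>I. (a i)\<^sup>2)"
  using assms
proof (induction I)
  case (insert i I)
  have "(\<Sum>x\<in>signs (insert i I). (rad a (insert i I) x)\<^sup>2)
      = (\<Sum>y\<in>signs I. 2 * (rad a I y)\<^sup>2 + 2 * (a i)\<^sup>2)"
    unfolding sum_signs_insert[OF insert.hyps] rad_insert[OF insert.hyps]
    by (rule sum.cong) (auto simp: power2_eq_square algebra_simps)
  then show ?case
    using insert by (simp add: sum.distrib flip: sum_distrib_left)
      (simp add: card_signs algebra_simps)
qed simp

lemma sum_rad_fourth_power_le: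
  assumes "finite I"
  shows "(\<Sum>x\<in>signs I. rad a I x ^ 4) \<le> 2 ^ card I * (3 * (\<Sum>i\<in>I. (a i)\<^sup>2)\<^sup>2)"
  using assms
proof (induction I)
  case (insert i I)
  define s where "s = (\<Sum>i\<in>I. (a i)\<^sup>2)"
  have "(\<Sum>x\<in>signs (insert i I). rad a (insert i I) x ^ 4)
      = (\<Sum>y\<in>signs I. 2 * rad a I y ^ 4 + 12 * (a i)\<^sup>2 * (rad a I y)\<^sup>2 + 2 * (a i) ^ 4)"
    unfolding sum_signs_insert[OF insert.hyps] rad_insert[OF insert.hyps]
    by (rule sum.cong) (auto simp: power2_eq_square power4_eq_xxxx algebra_simps)
  also have "\<dots> = 2 * (\<Sum>y\<in>signs I. rad a I y ^ 4) + 12 * (a i)\<^sup>2 * (2 ^ card I * s)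
      + 2 ^ card I * (2 * (a i) ^ 4)"
    using insert.hyps by (simp add: sum.distrib s_def sum_rad_square card_signs flip: sum_distrib_left)
  also have "\<dots> \<le> 2 * (2 ^ card I * (3 * s\<^sup>2)) + 12 * (a i)\<^sup>2 * (2 ^ card I * s)
      + 2 ^ card I * (2 * (a i) ^ 4)"
    using insert.IH by (simp add: s_def)
  also have "\<dots> = 2 ^ Suc (card I) * (3 * s\<^sup>2 + 6 * (a i)\<^sup>2 * s + (a i) ^ 4)"
    by (simp add: algebra_simps)
  also have "\<dots> \<le> 2 ^ Suc (card I) * (3 * ((a i)\<^sup>2 + s)\<^sup>2)"
    using zero_le_even_power[of 4 "a i"]
    by (intro mult_left_mono) (auto simp: power2_eq_square power4_eq_xxxx algebra_simps)
  finally show ?case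
    using insert.hyps by (simp add: s_def)
qed simp

text \<open>
  Hoeffding's lemma for a fair sign. In the form \<open>ln (1 + p (e\<^sup>h - 1)) - h p \<le> h\<^sup>2 / 8\<close>, with \<open>p = 1/2\<close> and
  \<open>h = 2 x\<close>, the left-hand side is \<open>ln (cosh x)\<close>.
\<close>

lemma cosh_le_exp_half_square: "cosh x \<le> exp (x\<^sup>2 / 2)" for x :: real
proof -
  have "cosh x \<le> exp (x\<^sup>2 / 2)" if "x \<ge> 0" for x :: real
  proof -
    have cosh_eq: "cosh x = exp (- x) * (1 + 1 / 2 * (exp (2 * x) - 1))"
      by (simp add: cosh_field_def field_simps flip: exp_add)
    have "ln (cosh x) = - (2 * x) * (1 / 2) + ln (1 + 1 / 2 * (exp (2 * x) - 1))"
      using exp_gt_zero[of "2 * x"] unfolding cosh_eq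
      by (subst ln_mult) (auto simp: field_simps simp del: exp_gt_zero)
    also have "\<dots> \<le> (2 * x)\<^sup>2 / 8"
      using that by (intro Hoeffdings_lemma_aux) auto
    finally have "ln (cosh x) \<le> x\<^sup>2 / 2"
      by (simp add: power_mult_distrib)
    then show ?thesis
      by (metis cosh_real_pos exp_le_cancel_iff exp_ln)
  qed
  from this[of x] this[of "- x"] show ?thesis
    by (cases "x \<ge> 0") auto
qed

text \<open>
  The subgaussian bound: averaging over one sign turns \<open>exp (l a\<^sub>i x\<^sub>i)\<close> into \<open>cosh (l a\<^sub>i)\<close>.
\<close>

lemma sum_exp_rad_le:
  assumes "finite I"
  shows "(\<Sum>x\<in>signs I. exp (l * rad a I x)) \<le> 2 ^ card I * exp (l\<^sup>2 * (\<Sum>i\<in>I. (a i)\<^sup>2) / 2)"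
  using assms
proof (induction I)
  case (insert i I)
  have "(\<Sum>x\<in>signs (insert i I). exp (l * rad a (insert i I) x))
      = (\<Sum>y\<in>signs I. 2 * cosh (l * a i) * exp (l * rad a I y))"
    unfolding sum_signs_insert[OF insert.hyps] rad_insert[OF insert.hyps]
    by (rule sum.cong) (auto simp: cosh_field_def ring_distribs exp_add exp_diff exp_minus field_simps)
  also have "\<dots> = 2 * cosh (l * a i) * (\<Sum>y\<in>signs I. exp (l * rad a I y))"
    by (simp add: sum_distrib_left)
  also have "\<dots> \<le> 2 * exp ((l * a i)\<^sup>2 / 2) * (2 ^ card I * exp (l\<^sup>2 * (\<Sum>i\<in>I. (a i)\<^sup>2) / 2))"
    by (intro mult_mono insert.IH cosh_le_exp_half_square mult_left_mono sum_nonneg) auto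
  also have "\<dots> = 2 ^ Suc (card I) * exp (l\<^sup>2 * ((a i)\<^sup>2 + (\<Sum>i\<in>I. (a i)\<^sup>2)) / 2)"
    by (simp add: algebra_simps add_divide_distrib exp_add power_mult_distrib)
  finally show ?case
    using insert.hyps by simp
qed simp

lemma card_signs_uminus:
  fixes a :: "'i \<Rightarrow> real"
  shows
  "card {x \<in> signs I. P (rad a I x)} = card {x \<in> signs I. P (- rad a I x)}"
proof (rule bij_betw_same_card)
  define neg where "neg x = (\<lambda>i\<in>I. - x i)" for x :: "'i \<Rightarrow> real"
  have "neg x \<in> signs I" if "x \<in> signs I" for x
    using that by (fastforce simp: neg_def PiE_iff)
  moreover have "rad a I (neg x) = - rad a I x" for x
    by (simp add: neg_def sum_negf)
  moreover have "neg (neg x) = x" if "x \<in> signs I" for x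
    using that by (auto simp: neg_def PiE_iff extensional_def fun_eq_iff)
  ultimately show "bij_betw neg {x \<in> signs I. P (rad a I x)} {x \<in> signs I. P (- rad a I x)}"
    by (intro bij_betw_byWitness[where f' = neg]) (auto simp del: PiE_iff)
qed

section \<open>Reverse Chernoff bound\<close>

text \<open>
  A form of the Paley-Zygmund inequality. With \<open>w = X\<^sup>2 / s\<close> the moment bounds say that \<open>w\<close> has mean 1
  and second moment at most 3, and the indicator of \<open>w \<ge> 1/4\<close> dominates the concave polynomial
  \<open>(w - 1/4) (8 - w) / 16\<close>, whose mean is therefore at least \<open>13/64\<close>.
\<close>

lemma card_abs_rad_ge:
  assumes I: "finite I" and s: "s = (\<Sum>i\<in>I. (a i)\<^sup>2)" "s > 0"
  shows "3 / 16 * 2 ^ card I \<le> real (card {x \<in> signs I. sqrt s / 2 \<le> \<bar>rad a I x\<bar>})"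
proof -
  let ?A = "{x \<in> signs I. sqrt s / 2 \<le> \<bar>rad a I x\<bar>}"
  have poly_le: "((rad a I x)\<^sup>2 - s / 4) * (8 * s - (rad a I x)\<^sup>2) \<le> 16 * s\<^sup>2 * indicator ?A x"
    if "x \<in> signs I" for x
  proof (cases "x \<in> ?A")
    case True
    define y where "y = (rad a I x)\<^sup>2"
    \<comment> \<open>The polynomial has its maximum halfway between its roots \<open>s / 4\<close> and \<open>8 * s\<close>.\<close>
    have "16 * s\<^sup>2 - (y - s / 4) * (8 * s - y) = (y - 33 / 8 * s)\<^sup>2 + (18 - 1089 / 64) * s\<^sup>2"
      by (simp add: power2_eq_square algebra_simps)
    also have "0 \<le> \<dots>"
      by simp
    finally have "(y - s / 4) * (8 * s - y) \<le> 16 * s\<^sup>2"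
      by simp
    then show ?thesis
      using True by (simp add: y_def)
  next
    case False
    then have "\<bar>rad a I x\<bar> \<le> sqrt s / 2"
      using that by auto
    then have "(rad a I x)\<^sup>2 \<le> (sqrt s / 2)\<^sup>2"
      by (metis abs_ge_zero power2_abs power_mono)
    then have "(rad a I x)\<^sup>2 \<le> s / 4"
      using s(2) by (simp add: power_divide)
    then show ?thesis
      using False s(2) by (auto intro!: mult_nonpos_nonneg)
  qed
  have "2 ^ card I * (13 / 4 * s\<^sup>2)
      \<le> 33 / 4 * s * (2 ^ card I * s) - 2 ^ card I * (3 * s\<^sup>2) - 2 ^ card I * (2 * s\<^sup>2)"
    by (simp add: power2_eq_square algebra_simps)
  also have "\<dots> \<le> 33 / 4 * s * (\<Sum>x\<in>signs I. (rad a I x)\<^sup>2) - (\<Sum>x\<in>signs I. rad a I x ^ 4)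
      - (\<Sum>x\<in>signs I. 2 * s\<^sup>2)"
    using sum_rad_fourth_power_le[OF I, of a] sum_rad_square[OF I, of a] I
    by (simp add: s(1)[symmetric] card_signs mult.commute mult.left_commute)
  also have "\<dots> = (\<Sum>x\<in>signs I. ((rad a I x)\<^sup>2 - s / 4) * (8 * s - (rad a I x)\<^sup>2))"
    unfolding sum_distrib_left sum_subtractf[symmetric]
    by (rule sum.cong) (auto simp: power2_eq_square power4_eq_xxxx algebra_simps)
  also have "\<dots> \<le> (\<Sum>x\<in>signs I. 16 * s\<^sup>2 * indicator ?A x)"
    by (intro sum_mono poly_le)
  also have "\<dots> = 16 * s\<^sup>2 * card ?A"
    using I by (simp add: indicator_def sum.If_cases Int_def flip: sum_distrib_left)
  finally have "s\<^sup>2 * (13 / 4 * 2 ^ card I) \<le> s\<^sup>2 * (16 * card ?A)"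
    by (simp add: algebra_simps)
  then have "13 / 4 * 2 ^ card I \<le> 16 * real (card ?A)"
    using s(2) by (simp only: mult_le_cancel_left_pos zero_less_power)
  then have "13 / 64 * 2 ^ card I \<le> real (card ?A)"
    by simp
  moreover have "3 / 16 * 2 ^ card I \<le> (13 / 64 * 2 ^ card I :: real)"
    by simp
  ultimately show ?thesis
    by linarith
qed

lemma card_rad_ge_half_deviation:
  assumes I: "finite I" and v: "0 < v" "v \<le> (\<Sum>i\<in>I. (a i)\<^sup>2)"
  shows "3 / 32 * 2 ^ card I \<le> real (card {x \<in> signs I. sqrt v / 2 \<le> rad a I x})"
proof -
  define s where "s = (\<Sum>i\<in>I. (a i)\<^sup>2)"
  let ?P = "{x \<in> signs I. sqrt s / 2 \<le> rad a I x}"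
  let ?M = "{x \<in> signs I. sqrt s / 2 \<le> - rad a I x}"
  have "3 / 16 * 2 ^ card I \<le> real (card {x \<in> signs I. sqrt s / 2 \<le> \<bar>rad a I x\<bar>})"
    using v by (intro card_abs_rad_ge I s_def) (auto simp: s_def)
  also have "card {x \<in> signs I. sqrt s / 2 \<le> \<bar>rad a I x\<bar>} \<le> card (?P \<union> ?M)"
    using I by (intro card_mono) auto
  also have "\<dots> \<le> card ?P + card ?M"
    by (rule card_Un_le)
  also have "card ?M = card ?P"
    using card_signs_uminus[of I "\<lambda>y. sqrt s / 2 \<le> y" a] by simp
  also have "sqrt v / 2 \<le> y" if "sqrt s / 2 \<le> y" for y
    using that v(2) real_sqrt_le_mono[of v s] unfolding s_def by linarith
  then have "card ?P \<le> card {x \<in> signs I. sqrt v / 2 \<le> rad a I x}"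
    using I by (intro card_mono) auto
  finally show ?thesis
    by simp
qed

text \<open>
  Independence of the signs on disjoint index sets: a pair of sign vectors glues to one on the union.
\<close>

lemma card_rad_ge_Un:
  assumes fin: "finite I" "finite J" and disj: "I \<inter> J = {}"
  shows "card {x \<in> signs I. \<alpha> \<le> rad a I x} * card {x \<in> signs J. \<beta> \<le> rad a J x}
       \<le> card {x \<in> signs (I \<union> J). \<alpha> + \<beta> \<le> rad a (I \<union> J) x}"
proof -
  define glue where "glue = (\<lambda>(x, y) i. if i \<in> I then x i else y i :: real)"
  let ?A = "{x \<in> signs I. \<alpha> \<le> rad a I x} \<times> {x \<in> signs J. \<beta> \<le> rad a J x}"
  have inj: "inj_on glue ?A"
  proof (rule inj_onI, clarsimp)
    fix x y x' y'
    assume xy: "x \<in> signs I" "x' \<in> signs I" "y \<in> signs J" "y' \<in> signs J"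
      and eq: "glue (x, y) = glue (x', y')"
    have *: "(if i \<in> I then x i else y i) = (if i \<in> I then x' i else y' i)" for i
      using fun_cong[OF eq, of i] by (simp add: glue_def)
    have "x i = x' i" if "i \<in> I" for i
      using *[of i] that by simp
    then have "x = x'"
      by (rule PiE_ext[OF xy(1,2)])
    moreover have "y i = y' i" if "i \<in> J" for i
      using *[of i] that disj by (simp split: if_splits) blast
    then have "y = y'"
      by (rule PiE_ext[OF xy(3,4)])
    ultimately show "x = x' \<and> y = y'" ..
  qed
  have "glue ` ?A \<subseteq> {x \<in> signs (I \<union> J). \<alpha> + \<beta> \<le> rad a (I \<union> J) x}"
  proof clarsimp
    fix x y
    assume xy: "x \<in> signs I" "y \<in> signs J" "\<alpha> \<le> rad a I x" "\<beta> \<le> rad a J y"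
    have "rad a I (glue (x, y)) = rad a I x"
      by (rule sum.cong) (auto simp: glue_def)
    moreover have "rad a J (glue (x, y)) = rad a J y"
      using disj by (intro sum.cong) (auto simp: glue_def)
    ultimately have "\<alpha> + \<beta> \<le> rad a (I \<union> J) (glue (x, y))"
      using xy by (simp add: sum.union_disjoint fin disj)
    moreover have "glue (x, y) \<in> signs (I \<union> J)"
      using PiE_mem[OF xy(1)] PiE_mem[OF xy(2)] PiE_arb[OF xy(2)]
      by (intro PiE_I) (auto simp: glue_def)
    ultimately show "glue (x, y) \<in> signs (I \<union> J) \<and> \<alpha> + \<beta> \<le> rad a (I \<union> J) (glue (x, y))"
      by simp
  qed
  then have "card (glue ` ?A) \<le> card {x \<in> signs (I \<union> J). \<alpha> + \<beta> \<le> rad a (I \<union> J) x}"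
    using fin by (intro card_mono) auto
  then show ?thesis
    using inj by (simp add: card_image card_cartesian_product)
qed

text \<open>
  Adding elements one at a time, the total weight cannot jump over the interval from \<open>v\<close> to \<open>2 * v\<close>.
  This is what cuts the coordinates into blocks of comparable variance.
\<close>

lemma ex_subset_sum_between:
  fixes w :: "'i \<Rightarrow> real"
  assumes "finite I" "\<And>i. i \<in> I \<Longrightarrow> w i \<le> v" "v \<le> sum w I" "0 < v"
  shows "\<exists>J\<subseteq>I. v \<le> sum w J \<and> sum w J \<le> 2 * v"
  using assms
proof (induction I)
  case (insert i I)
  show ?case
  proof (cases "v \<le> sum w I")
    case True
    then have "\<exists>J\<subseteq>I. v \<le> sum w J \<and> sum w J \<le> 2 * v"
      using insert.prems by (intro insert.IH) auto
    then show ?thesis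
      by blast
  next
    case False
    then have "sum w (insert i I) \<le> 2 * v"
      using insert.hyps insert.prems(1)[of i] by simp
    then show ?thesis
      using insert.prems(2) by (intro exI[of _ "insert i I"]) auto
  qed
qed simp

text \<open>
  Cut off a block of variance between \<open>v\<close> and \<open>2 * v\<close>, \<open>m\<close> times. Each block sum is at least
  \<open>sqrt v / 2\<close> with probability at least \<open>3/32\<close>, independently of the others; what is left over is
  nonnegative with probability at least \<open>1/2\<close>.
\<close>

lemma card_rad_ge_blocks:
  assumes "finite I" "\<And>i. i \<in> I \<Longrightarrow> (a i)\<^sup>2 \<le> v" "0 < v" "2 * real m * v \<le> (\<Sum>i\<in>I. (a i)\<^sup>2)"
  shows "1 / 2 * (3 / 32) ^ m * 2 ^ card I
       \<le> real (card {x \<in> signs I. real m * (sqrt v / 2) \<le> rad a I x})"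
  using assms
proof (induction m arbitrary: I)
  case 0
  have "signs I \<subseteq> {x \<in> signs I. 0 \<le> rad a I x} \<union> {x \<in> signs I. 0 \<le> - rad a I x}"
    by auto
  then have "card (signs I) \<le> card ({x \<in> signs I. 0 \<le> rad a I x} \<union> {x \<in> signs I. 0 \<le> - rad a I x})"
    using 0 by (intro card_mono) auto
  also have "\<dots> \<le> card {x \<in> signs I. 0 \<le> rad a I x} + card {x \<in> signs I. 0 \<le> - rad a I x}"
    by (rule card_Un_le)
  also have "\<dots> = 2 * card {x \<in> signs I. 0 \<le> rad a I x}"
    using card_signs_uminus[of I "\<lambda>y. 0 \<le> y" a] by simp
  finally have "real (card (signs I)) \<le> 2 * real (card {x \<in> signs I. 0 \<le> rad a I x})"
    by linarith
  then show ?case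
    using 0 by (simp add: card_signs)
next
  case (Suc m)
  have "v \<le> 2 * real (Suc m) * v"
    using Suc.prems by (simp add: algebra_simps)
  then have "v \<le> (\<Sum>i\<in>I. (a i)\<^sup>2)"
    using Suc.prems(4) by linarith
  then obtain J where J: "J \<subseteq> I" "v \<le> (\<Sum>i\<in>J. (a i)\<^sup>2)" "(\<Sum>i\<in>J. (a i)\<^sup>2) \<le> 2 * v"
    using ex_subset_sum_between[of I "\<lambda>i. (a i)\<^sup>2" v] Suc.prems by metis
  then have finJ: "finite J"
    using Suc.prems finite_subset by blast
  let ?P = "card {x \<in> signs J. sqrt v / 2 \<le> rad a J x}"
  let ?Q = "card {x \<in> signs (I - J). real m * (sqrt v / 2) \<le> rad a (I - J) x}"
  have "(\<Sum>i\<in>I - J. (a i)\<^sup>2) = (\<Sum>i\<in>I. (a i)\<^sup>2) - (\<Sum>i\<in>J. (a i)\<^sup>2)"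
    using Suc.prems J by (intro sum_diff) auto
  also have "\<dots> \<ge> 2 * real m * v"
    using Suc.prems(4) J(3) by (simp add: algebra_simps)
  finally have Q: "1 / 2 * (3 / 32) ^ m * 2 ^ card (I - J) \<le> real ?Q"
    using Suc.prems by (intro Suc.IH) auto
  have P: "3 / 32 * 2 ^ card J \<le> real ?P"
    using J finJ Suc.prems by (intro card_rad_ge_half_deviation) auto
  have "card I = card J + card (I - J)"
    using J Suc.prems finJ by (metis card_Diff_subset card_mono le_add_diff_inverse)
  then have "1 / 2 * (3 / 32 :: real) ^ Suc m * 2 ^ card I
      = (3 / 32 * 2 ^ card J) * (1 / 2 * (3 / 32) ^ m * 2 ^ card (I - J))"
    by (simp add: power_add)
  also have "\<dots> \<le> real ?P * real ?Q"
    by (intro mult_mono P Q) auto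
  also have "\<dots> = real (?P * ?Q)"
    by simp
  also have "?P * ?Q \<le> card {x \<in> signs (J \<union> (I - J)). sqrt v / 2 + real m * (sqrt v / 2)
      \<le> rad a (J \<union> (I - J)) x}"
    using finJ Suc.prems by (intro card_rad_ge_Un) auto
  also have "J \<union> (I - J) = I"
    using J by auto
  also have "sqrt v / 2 + real m * (sqrt v / 2) = real (Suc m) * (sqrt v / 2)"
    by (simp add: algebra_simps)
  finally show ?case
    by (simp only: of_nat_le_iff)
qed

text \<open>
  Tails of Gaussian size persist in the range \<open>s = O(1 / \<alpha>)\<close>: about \<open>16 s\<^sup>2\<close> blocks of variance at least
  \<open>v = 1 / (2 m)\<close> are available as long as no single coefficient exceeds \<open>sqrt v\<close>, and if all of them
  deviate, the sum exceeds \<open>m sqrt v / 2 = sqrt (m / 8) > s\<close>.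
\<close>

lemma card_rad_gt_ge_exp:
  assumes I: "finite I" and a: "\<And>i. i \<in> I \<Longrightarrow> \<bar>a i\<bar> \<le> \<alpha>" and unit: "(\<Sum>i\<in>I. (a i)\<^sup>2) = 1"
    and s: "1 / 2 \<le> s" "32 * (\<alpha> * s)\<^sup>2 \<le> 1"
  shows "exp (- 64 * s\<^sup>2) * 2 ^ card I \<le> real (card {x \<in> signs I. s < rad a I x})"
proof -
  define m where "m = nat \<lfloor>16 * s\<^sup>2\<rfloor>"
  define v where "v = 1 / (2 * real m)"
  have s2: "1 / 4 \<le> s\<^sup>2"
    using power_mono[OF s(1), of 2] by (simp add: power2_eq_square)
  have m_le: "real m \<le> 16 * s\<^sup>2" and m_gt: "8 * s\<^sup>2 < real m"
    using s2 unfolding m_def by linarith+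
  then have "1 \<le> m"
    using s2 by linarith
  then have v: "0 < v" "2 * real m * v = 1"
    by (auto simp: v_def)
  have small: "(a i)\<^sup>2 \<le> v" if "i \<in> I" for i
  proof -
    have "(a i)\<^sup>2 * (2 * real m) \<le> \<alpha>\<^sup>2 * (32 * s\<^sup>2)"
    proof (rule mult_mono)
      show "(a i)\<^sup>2 \<le> \<alpha>\<^sup>2"
        using power_mono[OF a[OF that], of 2] by simp
      show "2 * real m \<le> 32 * s\<^sup>2"
        using m_le by linarith
    qed auto
    also have "\<dots> \<le> 1"
      using s(2) by (simp add: power_mult_distrib algebra_simps)
    finally show ?thesis
      using \<open>1 \<le> m\<close> by (simp add: v_def field_simps)
  qed
  have "s\<^sup>2 < (real m * (sqrt v / 2))\<^sup>2"
  proof -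
    have "(real m * (sqrt v / 2))\<^sup>2 = (real m)\<^sup>2 * v / 4"
      using v by (simp add: power_mult_distrib power_divide)
    also have "\<dots> = real m / 8"
      using \<open>1 \<le> m\<close> by (simp add: v_def power2_eq_square)
    finally show ?thesis
      using m_gt by simp
  qed
  then have s_less: "s < real m * (sqrt v / 2)"
    using v by (intro power_less_imp_less_base[of s 2]) auto
  have "64 / 3 \<le> (3 / 2 :: real) ^ 8"
    by (simp add: power_divide)
  also have "\<dots> \<le> exp (1 / 2) ^ 8"
    using exp_ge_add_one_self[of "1 / 2 :: real"] by (intro power_mono) auto
  also have "\<dots> = exp 4"
    by (simp flip: exp_of_nat_mult)
  finally have "exp (- 4) \<le> (3 / 64 :: real)"
    by (simp add: exp_minus field_simps)
  have "exp (- 64 * s\<^sup>2) \<le> exp (real m * (- 4))"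
    using m_le by simp
  also have "\<dots> = exp (- 4) ^ m"
    by (rule exp_of_nat_mult)
  also have "\<dots> \<le> (3 / 64) ^ m"
    using \<open>exp (- 4) \<le> 3 / 64\<close> by (intro power_mono) auto
  also have "\<dots> = (1 / 2) ^ m * (3 / 32) ^ m"
    by (simp flip: power_mult_distrib)
  also have "\<dots> \<le> (1 / 2) ^ 1 * (3 / 32) ^ m"
    using \<open>1 \<le> m\<close> by (intro mult_right_mono power_decreasing) auto
  finally have "exp (- 64 * s\<^sup>2) * 2 ^ card I \<le> 1 / 2 * (3 / 32) ^ m * 2 ^ card I"
    by (intro mult_right_mono) auto
  also have "\<dots> \<le> real (card {x \<in> signs I. real m * (sqrt v / 2) \<le> rad a I x})"
    using I small v unit by (intro card_rad_ge_blocks) auto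
  also have "\<dots> \<le> real (card {x \<in> signs I. s < rad a I x})"
    using I s_less by (intro of_nat_mono card_mono) auto
  finally show ?thesis .
qed

section \<open>The flip identity\<close>

lemma flip_in_signs: "x \<in> signs I \<Longrightarrow> i \<in> I \<Longrightarrow> flip x i \<in> signs I"
  by (fastforce simp: flip_def PiE_iff extensional_def)

lemma flip_flip [simp]: "flip (flip x i) i = x"
  by (simp add: flip_def)

lemma flip_same [simp]: "flip x i i = - x i"
  by (simp add: flip_def)

lemma rad_flip:
  assumes "finite I" "i \<in> I"
  shows "rad a I (flip x i) = rad a I x - 2 * (a i * x i)"
proof -
  have "rad a (I - {i}) (flip x i) = rad a (I - {i}) x"
    by (rule sum.cong) (auto simp: flip_def)
  then show ?thesis
    using assms by (simp add: sum.remove[of I i])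
qed

lemma signs_cases: "x \<in> signs I \<Longrightarrow> i \<in> I \<Longrightarrow> x i = 1 \<or> x i = - 1"
  by (auto simp: PiE_iff)

lemma sum_signs_flip:
  assumes "i \<in> I"
  shows "(\<Sum>x\<in>signs I. h (flip x i)) = (\<Sum>x\<in>signs I. h x)"
  using assms by (intro sum.reindex_bij_witness[where i = "\<lambda>x. flip x i" and j = "\<lambda>x. flip x i"])
    (simp_all add: flip_in_signs)

text \<open>
  A discrete integration by parts: flipping coordinate \<open>i\<close> preserves the uniform measure and changes
  the sign of \<open>x\<^sub>i\<close>, so that the level-one coefficient of \<open>G(X)\<close> at \<open>i\<close> is half its mean derivative in
  direction \<open>i\<close>. This links the mean of \<open>X G(X)\<close> to the mass of the places where \<open>G\<close> varies.
\<close>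

lemma sum_rad_mult_eq:
  fixes G :: "real \<Rightarrow> real"
  assumes "finite I"
  shows "(\<Sum>x\<in>signs I. rad a I x * G (rad a I x))
    = (\<Sum>i\<in>I. a i * (\<Sum>x\<in>signs I. x i * (G (rad a I x) - G (rad a I (flip x i))))) / 2"
proof -
  have half: "(\<Sum>x\<in>signs I. x i * (G (rad a I x) - G (rad a I (flip x i))))
      = 2 * (\<Sum>x\<in>signs I. x i * G (rad a I x))" if "i \<in> I" for i
  proof -
    have "(\<Sum>x\<in>signs I. x i * G (rad a I (flip x i)))
        = (\<Sum>x\<in>signs I. - (flip x i i * G (rad a I (flip x i))))"
      by simp
    also have "\<dots> = (\<Sum>x\<in>signs I. - (x i * G (rad a I x)))"
      using that by (rule sum_signs_flip)
    finally show ?thesis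
      by (simp add: right_diff_distrib sum_subtractf sum_negf)
  qed
  have "(\<Sum>x\<in>signs I. rad a I x * G (rad a I x))
      = (\<Sum>x\<in>signs I. \<Sum>i\<in>I. a i * (x i * G (rad a I x)))"
    by (simp add: sum_distrib_right mult.assoc)
  also have "\<dots> = (\<Sum>i\<in>I. a i * (\<Sum>x\<in>signs I. x i * G (rad a I x)))"
    by (subst sum.swap) (simp add: sum_distrib_left)
  also have "\<dots> = (\<Sum>i\<in>I. a i * (\<Sum>x\<in>signs I. x i * (G (rad a I x) - G (rad a I (flip x i))))) / 2"
    by (simp add: half sum_divide_distrib)
  finally show ?thesis .
qed

section \<open>The upper bound\<close>

text \<open>
  The level-one inequality for an event of small probability \<open>p\<close>: conditioning on it raises the mean
  of a subgaussian variable by at most a multiple of \<open>sqrt (ln (1 / p))\<close>. Instead of Jensen's inequality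
  the proof uses the linear bound \<open>l u \<le> s + exp (l u - s)\<close>, where \<open>s\<close> is chosen such that the
  exponential contributes just \<open>p\<close>, and \<open>l = sqrt (ln (1 / p))\<close> balances the two terms.
\<close>

lemma sum_rad_mult_le:
  fixes G :: "real \<Rightarrow> real"
  assumes I: "finite I" and unit: "(\<Sum>i\<in>I. (a i)\<^sup>2) = 1"
    and G: "\<And>u. 0 \<le> G u" "\<And>u. G u \<le> (if t < u then 1 else 0)"
    and p: "p * 2 ^ card I = real (card {x \<in> signs I. t < rad a I x})" "0 < p" "p \<le> 1 / 2"
  shows "(\<Sum>x\<in>signs I. rad a I x * G (rad a I x)) \<le> 4 * p * sqrt (ln (1 / p)) * 2 ^ card I"
proof -
  define l where "l = sqrt (ln (1 / p))"
  define s where "s = l\<^sup>2 / 2 + ln (1 / p)"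
  have "ln 2 \<le> ln (1 / p)"
    using p by (subst ln_le_cancel_iff) (auto simp: field_simps)
  moreover have "1 / 2 \<le> ln (2 :: real)"
    using exp_half_le2 ln_ge_iff[of 2 "1 / 2"] by linarith
  ultimately have ln_p: "1 / 2 \<le> ln (1 / p)"
    by simp
  then have l: "0 < l" "l\<^sup>2 = ln (1 / p)"
    by (auto simp: l_def)
  have "0 \<le> s"
    using ln_p by (simp add: s_def)
  have pointwise: "l * rad a I x * G (rad a I x)
      \<le> s * (if t < rad a I x then 1 else 0) + exp (- s) * exp (l * rad a I x)" for x
  proof -
    define u where "u = rad a I x"
    have "l * u \<le> s + exp (l * u - s)"
      using exp_ge_add_one_self[of "l * u - s"] by linarith
    then have "l * u * G u \<le> (s + exp (l * u - s)) * G u"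
      using G(1) by (rule mult_right_mono)
    also have "\<dots> \<le> s * (if t < u then 1 else 0) + exp (l * u - s) * 1"
      using G(1,2)[of u] \<open>0 \<le> s\<close> unfolding distrib_right
      by (intro add_mono mult_left_mono) (auto split: if_splits)
    finally show ?thesis
      by (simp add: u_def exp_diff exp_minus divide_inverse mult.commute)
  qed
  have "l * (\<Sum>x\<in>signs I. rad a I x * G (rad a I x))
      = (\<Sum>x\<in>signs I. l * rad a I x * G (rad a I x))"
    by (rule trans[OF sum_distrib_left]) (simp add: mult.assoc)
  also have "\<dots> \<le> (\<Sum>x\<in>signs I. s * (if t < rad a I x then 1 else 0) + exp (- s) * exp (l * rad a I x))"
    by (intro sum_mono pointwise)
  also have "\<dots> = s * (p * 2 ^ card I) + exp (- s) * (\<Sum>x\<in>signs I. exp (l * rad a I x))"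
    unfolding sum.distrib sum_distrib_left[symmetric] using I
    by (simp add: p(1) sum.If_cases Int_def)
  also have "\<dots> \<le> s * (p * 2 ^ card I) + exp (- s) * (2 ^ card I * exp (l\<^sup>2 / 2))"
    using sum_exp_rad_le[OF I, of l a] unit by simp
  also have "exp (- s) * (2 ^ card I * exp (l\<^sup>2 / 2)) = 2 ^ card I * exp (- ln (1 / p))"
    by (simp add: s_def mult.left_commute[of "exp _"] flip: exp_add)
  also have "exp (- ln (1 / p)) = p"
    using p by (simp add: ln_div)
  also have "s * (p * 2 ^ card I) + 2 ^ card I * p = (3 / 2 * l\<^sup>2 + 1) * (p * 2 ^ card I)"
    using l by (simp add: s_def algebra_simps)
  also have "\<dots> \<le> (4 * l\<^sup>2) * (p * 2 ^ card I)"
    using ln_p l p by (intro mult_right_mono) auto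
  also have "\<dots> = l * (4 * p * l * 2 ^ card I)"
    by (simp add: power2_eq_square)
  finally show ?thesis
    using l(1) unfolding l_def by (simp only: mult_le_cancel_left_pos)
qed

text \<open>
  The test function \<open>G\<close> jumps to \<open>1/2\<close> at \<open>t\<close> and then grows with slope \<open>1 / (8 \<alpha>)\<close> up to \<open>t + 4 \<alpha>\<close>. An
  edge in direction \<open>i\<close> that has an endpoint in the window from \<open>t\<close> to \<open>t + 2 \<alpha>\<close> either crosses the
  jump or stays within the slope, because its length is \<open>2 a\<^sub>i \<le> 2 \<alpha>\<close>. In both cases \<open>G\<close> varies by at
  least \<open>a\<^sub>i / (4 \<alpha>)\<close> along it; summing \<open>a\<^sub>i\<^sup>2\<close> over the directions gives 1. The jump is what keeps \<open>G\<close>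
  supported above \<open>t\<close>, so that the right-hand side involves \<open>p\<close> itself and not a larger tail.
\<close>

lemma card_window_le:
  fixes I :: "nat set"
  assumes I: "finite I" and a: "\<And>i. i \<in> I \<Longrightarrow> 0 \<le> a i \<and> a i \<le> \<alpha>" and "0 < \<alpha>"
    and unit: "(\<Sum>i\<in>I. (a i)\<^sup>2) = 1"
    and p: "p * 2 ^ card I = real (card {x \<in> signs I. t < rad a I x})" "0 < p" "p \<le> 1 / 2"
  shows "real (card {x \<in> signs I. t < rad a I x \<and> rad a I x \<le> t + 2 * \<alpha>})
    \<le> 32 * (p * (\<alpha> * sqrt (ln (1 / p)))) * 2 ^ card I"
proof -
  let ?W = "{x \<in> signs I. t < rad a I x \<and> rad a I x \<le> t + 2 * \<alpha>}"
  define G where "G u = (if t < u then 1 / 2 + min (1 / 2) ((u - t) / (8 * \<alpha>)) else 0)" for u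
  have G_mono: "G u \<le> G v" if "u \<le> v" for u v
    using that \<open>0 < \<alpha>\<close> by (auto simp: G_def min_def field_simps)
  have G_nonneg: "0 \<le> G u" for u
    using \<open>0 < \<alpha>\<close> by (simp add: G_def min_def)
  have G_le: "G u \<le> (if t < u then 1 else 0)" for u
    using min.cobounded1[of "1 / 2" "(u - t) / (8 * \<alpha>)"] by (simp add: G_def)
  have G_step: "d / (4 * \<alpha>) \<le> G v - G u"
    if v: "v = u + 2 * d" and d: "0 \<le> d" "d \<le> \<alpha>"
      and W: "t < u \<and> u \<le> t + 2 * \<alpha> \<or> t < v \<and> v \<le> t + 2 * \<alpha>" for u v d
  proof (cases "t < u")
    case True
    then have "v - t \<le> 4 * \<alpha>" "u - t \<le> 4 * \<alpha>" "t < v"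
      using v d W by auto
    moreover have "(w - t) / (8 * \<alpha>) \<le> 1 / 2" if "w - t \<le> 4 * \<alpha>" for w
      using that \<open>0 < \<alpha>\<close> by (simp add: divide_le_eq)
    ultimately have "G v - G u = (v - t) / (8 * \<alpha>) - (u - t) / (8 * \<alpha>)"
      using True by (simp add: G_def)
    then show ?thesis
      using v by (simp flip: diff_divide_distrib)
  next
    case False
    then have "t < v"
      using W by auto
    then have "1 / 2 \<le> G v"
      using \<open>0 < \<alpha>\<close> by (simp add: G_def)
    moreover have "d / (4 * \<alpha>) \<le> 1 / 2"
      using d \<open>0 < \<alpha>\<close> by (simp add: divide_le_eq)
    ultimately show ?thesis
      using False by (simp add: G_def)
  qed
  have term_ge: "a i / (4 * \<alpha>) * indicator ?W x \<le> x i * (G (rad a I x) - G (rad a I (flip x i)))"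
    if x: "x \<in> signs I" and i: "i \<in> I" for x i
  proof -
    note flip = rad_flip[OF I i, of a x]
    consider (up) "x i = 1" | (down) "x i = - 1"
      using signs_cases[OF x i] by blast
    then show ?thesis
    proof cases
      case up
      then have "rad a I x = rad a I (flip x i) + 2 * a i"
        using flip by simp
      then show ?thesis
        using G_step[of "rad a I x" "rad a I (flip x i)" "a i"] G_mono[of "rad a I (flip x i)" "rad a I x"]
          a[OF i] up x by (auto simp: indicator_def)
    next
      case down
      then have "rad a I (flip x i) = rad a I x + 2 * a i"
        using flip by simp
      then show ?thesis
        using G_step[of "rad a I (flip x i)" "rad a I x" "a i"] G_mono[of "rad a I x" "rad a I (flip x i)"]
          a[OF i] down x by (auto simp: indicator_def)
    qed
  qed
  have card_W: "(\<Sum>x\<in>signs I. indicator ?W x) = real (card ?W)"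
    using I by (simp add: indicator_def sum.If_cases Int_def)
  have "real (card ?W) / (4 * \<alpha>) / 2 = (\<Sum>i\<in>I. (a i)\<^sup>2) * (real (card ?W) / (4 * \<alpha>)) / 2"
    by (simp add: unit)
  also have "\<dots> = (\<Sum>i\<in>I. a i * (a i * (real (card ?W) / (4 * \<alpha>)))) / 2"
    by (simp only: sum_distrib_right power2_eq_square mult.assoc)
  also have "\<dots> = (\<Sum>i\<in>I. a i * (a i / (4 * \<alpha>) * real (card ?W))) / 2"
    by simp
  also have "\<dots> = (\<Sum>i\<in>I. a i * (\<Sum>x\<in>signs I. a i / (4 * \<alpha>) * indicator ?W x)) / 2"
    by (simp only: card_W flip: sum_distrib_left)
  also have "\<dots> \<le> (\<Sum>i\<in>I. a i * (\<Sum>x\<in>signs I. x i * (G (rad a I x) - G (rad a I (flip x i))))) / 2"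
    using a by (intro divide_right_mono sum_mono mult_left_mono term_ge) auto
  also have "\<dots> = (\<Sum>x\<in>signs I. rad a I x * G (rad a I x))"
    by (rule sum_rad_mult_eq[OF I, symmetric])
  also have "\<dots> \<le> 4 * p * sqrt (ln (1 / p)) * 2 ^ card I"
    by (intro sum_rad_mult_le[where t = t] I unit p G_nonneg G_le)
  finally show ?thesis
    using \<open>0 < \<alpha>\<close> by (simp add: field_simps)
qed

section \<open>Boundary and window\<close>

definition inner_boundary :: "(nat \<Rightarrow> real) \<Rightarrow> nat set \<Rightarrow> real \<Rightarrow> (nat \<Rightarrow> real) set" where
  "inner_boundary a I t = {x \<in> signs I. t < rad a I x \<and> (\<exists>i\<in>I. rad a I (flip x i) \<le> t)}"

lemma inner_boundary_subset: "inner_boundary a I t \<subseteq> signs I"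
  by (auto simp: inner_boundary_def)

lemma finite_inner_boundary [simp]: "finite I \<Longrightarrow> finite (inner_boundary a I t)"
  using finite_subset[OF inner_boundary_subset] by simp

lemma inner_boundary_subset_window:
  assumes I: "finite I" and a: "\<And>i. i \<in> I \<Longrightarrow> 0 \<le> a i \<and> a i \<le> \<alpha>"
  shows "inner_boundary a I t \<subseteq> {x \<in> signs I. t < rad a I x \<and> rad a I x \<le> t + 2 * \<alpha>}"
proof (clarsimp simp: inner_boundary_def)
  fix x i
  assume x: "x \<in> signs I" and i: "i \<in> I" and le: "rad a I (flip x i) \<le> t"
  have "a i * x i \<le> \<alpha>"
    using signs_cases[OF x i] a[OF i] by auto
  then show "rad a I x \<le> t + 2 * \<alpha>"
    using le rad_flip[OF I i, of a x] by linarith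
qed

text \<open>
  A ramp is constant off the window from \<open>t\<close> to \<open>t + \<alpha>\<close>, so that it varies only along edges which jump
  over the point \<open>t\<close> (their upper endpoint is a boundary point) or have an endpoint in the window.
  By the Lipschitz bound each edge in direction \<open>i\<close> contributes at most \<open>2 a\<^sub>i / \<alpha>\<close>.
\<close>

lemma sum_rad_ramp_le:
  assumes I: "finite I" and a: "\<And>i. i \<in> I \<Longrightarrow> 0 \<le> a i" and "0 < \<alpha>"
    and unit: "(\<Sum>i\<in>I. (a i)\<^sup>2) = 1"
  shows "\<alpha> * (\<Sum>x\<in>signs I. rad a I x * max 0 (min 1 ((rad a I x - t) / \<alpha>)))
    \<le> 2 * real (card (inner_boundary a I t \<union> {x \<in> signs I. t < rad a I x \<and> rad a I x \<le> t + \<alpha>}))"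
proof -
  let ?V = "inner_boundary a I t \<union> {x \<in> signs I. t < rad a I x \<and> rad a I x \<le> t + \<alpha>}"
  have V: "?V \<subseteq> signs I"
    using inner_boundary_subset by auto
  define G where "G u = max 0 (min 1 ((u - t) / \<alpha>))" for u
  have G_lipschitz: "\<bar>G u - G v\<bar> \<le> \<bar>u - v\<bar> / \<alpha>" for u v
  proof -
    have "\<bar>G u - G v\<bar> \<le> \<bar>(u - t) / \<alpha> - (v - t) / \<alpha>\<bar>"
      unfolding G_def by linarith
    also have "\<dots> = \<bar>u - v\<bar> / \<alpha>"
      using \<open>0 < \<alpha>\<close> by (simp add: abs_divide flip: diff_divide_distrib)
    finally show ?thesis .
  qed
  have G_flat: "G u = G v" if "u \<le> t \<and> v \<le> t \<or> t + \<alpha> < u \<and> t + \<alpha> < v" for u v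
  proof -
    have "G w = 0" if "w \<le> t" for w
      using that divide_nonpos_pos[of "w - t" \<alpha>] \<open>0 < \<alpha>\<close> unfolding G_def by linarith
    moreover have "G w = 1" if "t + \<alpha> < w" for w
      using that \<open>0 < \<alpha>\<close> by (simp add: G_def min_def)
    ultimately show ?thesis
      using that by auto
  qed
  have term_le: "x i * (G (rad a I x) - G (rad a I (flip x i)))
      \<le> 2 * a i / \<alpha> * (indicator ?V x + indicator ?V (flip x i))"
    if x: "x \<in> signs I" and i: "i \<in> I" for x i
  proof (cases "x \<in> ?V \<or> flip x i \<in> ?V")
    case True
    have "x i * (G (rad a I x) - G (rad a I (flip x i))) \<le> \<bar>G (rad a I x) - G (rad a I (flip x i))\<bar>"
      using signs_cases[OF x i] by auto
    also have "\<dots> \<le> \<bar>2 * (a i * x i)\<bar> / \<alpha>"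
      using G_lipschitz[of "rad a I x" "rad a I (flip x i)"] rad_flip[OF I i, of a x] by simp
    also have "\<dots> = 2 * a i / \<alpha> * 1"
      using signs_cases[OF x i] a[OF i] by auto
    also have "\<dots> \<le> 2 * a i / \<alpha> * (indicator ?V x + indicator ?V (flip x i))"
      using True a[OF i] \<open>0 < \<alpha>\<close> by (intro mult_left_mono) (auto simp: indicator_def)
    finally show ?thesis .
  next
    case False
    then have "\<not> (t < rad a I x \<and> rad a I x \<le> t + \<alpha>)"
        "\<not> (t < rad a I (flip x i) \<and> rad a I (flip x i) \<le> t + \<alpha>)"
        "\<not> (t < rad a I x \<and> rad a I (flip x i) \<le> t)"
      using x flip_in_signs[OF x i] i by (auto simp: inner_boundary_def)
    moreover have "\<not> (t < rad a I (flip x i) \<and> rad a I x \<le> t)"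
    proof
      assume "t < rad a I (flip x i) \<and> rad a I x \<le> t"
      then have "flip x i \<in> inner_boundary a I t"
        using flip_in_signs[OF x i] i unfolding inner_boundary_def by (auto intro!: bexI[of _ i])
      then show False
        using False by simp
    qed
    ultimately have "G (rad a I x) = G (rad a I (flip x i))"
      by (intro G_flat) linarith
    then show ?thesis
      using a[OF i] \<open>0 < \<alpha>\<close> by simp
  qed
  have "(\<Sum>x\<in>signs I. indicator ?V x) = (\<Sum>x\<in>?V. 1 :: real)"
    by (rule sum.mono_neutral_cong_right) (use I V in auto)
  then have card_V: "(\<Sum>x\<in>signs I. indicator ?V x) = real (card ?V)"
    by simp
  have "\<alpha> * (\<Sum>x\<in>signs I. rad a I x * G (rad a I x))
      = \<alpha> * ((\<Sum>i\<in>I. a i * (\<Sum>x\<in>signs I. x i * (G (rad a I x) - G (rad a I (flip x i))))) / 2)"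
    using sum_rad_mult_eq[OF I, of a G] by simp
  also have "\<dots> \<le> \<alpha> * ((\<Sum>i\<in>I. a i * (\<Sum>x\<in>signs I.
      2 * a i / \<alpha> * (indicator ?V x + indicator ?V (flip x i)))) / 2)"
    using a \<open>0 < \<alpha>\<close> by (intro mult_left_mono divide_right_mono sum_mono term_le) auto
  also have "\<dots> = \<alpha> * ((\<Sum>i\<in>I. a i * (2 * a i / \<alpha> * (2 * real (card ?V)))) / 2)"
    by (simp only: sum_distrib_left[symmetric] sum.distrib sum_signs_flip card_V mult_2 cong: sum.cong)
  also have "(\<Sum>i\<in>I. a i * (2 * a i / \<alpha> * (2 * real (card ?V))))
      = (\<Sum>i\<in>I. (a i)\<^sup>2 * (4 * real (card ?V) / \<alpha>))"
    by (rule sum.cong) (auto simp: power2_eq_square)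
  also have "\<dots> = (\<Sum>i\<in>I. (a i)\<^sup>2) * (4 * real (card ?V) / \<alpha>)"
    by (rule sum_distrib_right[symmetric])
  finally show ?thesis
    using \<open>0 < \<alpha>\<close> by (simp add: unit G_def)
qed

text \<open>
  A reflection argument. Let \<open>x\<close> lie in the window from \<open>t\<close> to \<open>t + a\<^sub>m\<close> but not in the boundary. Call
  \<open>i\<close> small if \<open>2 a\<^sub>i < a\<^sub>m\<close>. All other coordinates of \<open>x\<close> equal \<open>-1\<close>, as lowering one of them from 1 would
  leave the halfspace. Raising \<open>x\<^sub>m\<close> to 1 adds \<open>2 a\<^sub>m\<close> to the sum, which may be too much; to compensate,
  the small coordinates are negated up to the first time that their partial sum \<open>S\<close> reaches
  \<open>a\<^sub>m / 2\<close>. Its steps are smaller than \<open>a\<^sub>m / 2\<close>, so that \<open>a\<^sub>m \<le> 2 S < 2 a\<^sub>m\<close> and the new sum lies above \<open>t\<close>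
  and at most \<open>2 a\<^sub>m\<close> above it, which makes \<open>m\<close> a direction that leaves the halfspace. As in the
  reflection principle, the stopping time can be recovered from the image, so that the map is injective.
\<close>

lemma card_window_diff_inner_boundary_le:
  assumes I: "finite I" and a: "\<And>i. i \<in> I \<Longrightarrow> 0 \<le> a i" and "m \<in> I" "0 < a m" and "0 \<le> t"
  shows "card ({x \<in> signs I. t < rad a I x \<and> rad a I x \<le> t + a m} - inner_boundary a I t)
       \<le> card (inner_boundary a I t)"
proof -
  let ?W = "{x \<in> signs I. t < rad a I x \<and> rad a I x \<le> t + a m} - inner_boundary a I t"
  \<comment> \<open>The bound \<open>k\<close> is strict, so that \<open>T 0\<close> is empty and the stopping time has a predecessor.\<close>
  define T where "T k = {i \<in> I. i < k \<and> 2 * a i < a m}" for k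
  define K where "K x = (LEAST k. a m \<le> 2 * rad a (T k) x)" for x
  define reflect where "reflect x i = (if i \<in> insert m (T (K x)) then - x i else x i :: real)" for x i
  have fin_T: "finite (T k)" and T_I: "T k \<subseteq> I" and m_T: "m \<notin> T k" for k
    using I \<open>0 < a m\<close> by (auto simp: T_def)
  have big: "x i = - 1" if x: "x \<in> ?W" and i: "i \<in> I" "a m \<le> 2 * a i" for x i
  proof (rule ccontr)
    assume "x i \<noteq> - 1"
    then have "x i = 1"
      using x i signs_cases[of x I i] by auto
    then have "rad a I (flip x i) \<le> t"
      using x i rad_flip[OF I i(1), of a x] by simp
    then show False
      using x i by (auto simp: inner_boundary_def)
  qed
  have K: "a m \<le> 2 * rad a (T (K x)) x" "2 * rad a (T (K x)) x < 2 * a m" if x: "x \<in> ?W" for x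
  proof -
    obtain k where k: "\<forall>i\<in>I. i < k"
      using I finite_nat_set_iff_bounded by blast
    \<comment> \<open>The partial sum does reach \<open>a m / 2\<close>: the coordinates that are not small are all \<open>-1\<close>, so that
      the small ones alone add up to more than \<open>t + a m\<close>.\<close>
    have "rad a (I - T k) x \<le> rad a {m} x"
    proof -
      have "rad a (I - T k) x = (\<Sum>i\<in>I - T k. - a i)"
        using big[OF x] k by (intro sum.cong) (auto simp: T_def)
      also have "\<dots> \<le> - (\<Sum>i\<in>{m}. a i)"
        using I a \<open>m \<in> I\<close> m_T sum_mono2[of "I - T k" "{m}" a] by (simp add: sum_negf)
      also have "\<dots> = rad a {m} x"
        using big[OF x \<open>m \<in> I\<close>] \<open>0 < a m\<close> by simp
      finally show ?thesis .
    qed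
    then have "rad a I x + a m \<le> rad a (T k) x"
      using big[OF x \<open>m \<in> I\<close>] \<open>0 < a m\<close> sum.subset_diff[OF T_I I, of "\<lambda>i. a i * x i" k] by simp
    then have "a m \<le> 2 * rad a (T k) x"
      using x \<open>0 \<le> t\<close> \<open>0 < a m\<close> by auto
    then show ge: "a m \<le> 2 * rad a (T (K x)) x"
      unfolding K_def by (rule LeastI)
    have "T 0 = {}"
      by (simp add: T_def)
    then have "K x \<noteq> 0"
      using ge \<open>0 < a m\<close> by (intro notI) simp
    then obtain j where j: "K x = Suc j"
      using not0_implies_Suc by blast
    have less: "2 * rad a (T j) x < a m"
      using not_less_Least[of j "\<lambda>k. a m \<le> 2 * rad a (T k) x"] j by (simp add: K_def)
    show "2 * rad a (T (K x)) x < 2 * a m"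
    proof (cases "j \<in> I \<and> 2 * a j < a m")
      case True
      then have "T (K x) = insert j (T j)" "j \<notin> T j"
        by (auto simp: T_def j)
      then have "rad a (T (K x)) x = a j * x j + rad a (T j) x"
        using fin_T by simp
      moreover have "a j * x j \<le> a j"
        using True x signs_cases[of x I j] a[of j] by auto
      ultimately show ?thesis
        using True less by linarith
    next
      case False
      then have "T (K x) = T j"
        by (auto simp: T_def j less_Suc_eq)
      then show ?thesis
        using less \<open>0 < a m\<close> by simp
    qed
  qed
  have reflect_mem: "reflect x \<in> inner_boundary a I t" if x: "x \<in> ?W" for x
  proof -
    have xm: "x m = - 1"
      using big[OF x \<open>m \<in> I\<close>] \<open>0 < a m\<close> by simp
    have "rad a I (reflect x)
        = (\<Sum>i\<in>I. a i * x i - 2 * (if i \<in> insert m (T (K x)) then a i * x i else 0))"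
      by (rule sum.cong) (auto simp: reflect_def)
    also have "\<dots> = rad a I x - 2 * (\<Sum>i\<in>I. if i \<in> insert m (T (K x)) then a i * x i else 0)"
      by (simp only: sum_subtractf sum_distrib_left)
    also have "(\<Sum>i\<in>I. if i \<in> insert m (T (K x)) then a i * x i else 0) = rad a (insert m (T (K x))) x"
      using I T_I \<open>m \<in> I\<close> by (subst sum.inter_restrict[symmetric]) (auto intro!: sum.cong)
    also have "\<dots> = - a m + rad a (T (K x)) x"
      using fin_T m_T xm by simp
    finally have rad_reflect: "rad a I (reflect x) = rad a I x + 2 * a m - 2 * rad a (T (K x)) x"
      by simp
    have signs: "reflect x \<in> signs I"
      using x T_I \<open>m \<in> I\<close> by (auto simp: reflect_def PiE_iff extensional_def)
    have "reflect x m = 1"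
      by (simp add: reflect_def xm)
    then have "rad a I (flip (reflect x) m) \<le> t"
      using rad_flip[OF I \<open>m \<in> I\<close>, of a "reflect x"] rad_reflect K[OF x] x by simp
    moreover have "t < rad a I (reflect x)"
      using rad_reflect K[OF x] x by simp
    ultimately show ?thesis
      using signs \<open>m \<in> I\<close> by (auto simp: inner_boundary_def)
  qed
  \<comment> \<open>Two vectors with the same image agree on the small coordinates before the earlier stopping time,
    which therefore stops both of them.\<close>
  have K_le: "K y \<le> K x" if x: "x \<in> ?W" and eq: "reflect x = reflect y" and le: "K x \<le> K y" for x y
  proof -
    have "x i = y i" if "i \<in> T (K x)" for i
    proof -
      have "i \<in> T (K y)"
        using that le by (auto simp: T_def)
      then show ?thesis
        using that fun_cong[OF eq, of i] by (simp add: reflect_def)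
    qed
    then have "rad a (T (K x)) y = rad a (T (K x)) x"
      by (intro sum.cong) auto
    then have "a m \<le> 2 * rad a (T (K x)) y"
      using K(1)[OF x] by simp
    then show ?thesis
      unfolding K_def[of y] by (rule Least_le)
  qed
  have "inj_on reflect ?W"
  proof (rule inj_onI)
    fix x y
    assume x: "x \<in> ?W" and y: "y \<in> ?W" and eq: "reflect x = reflect y"
    have "K x = K y"
      using K_le[OF x eq] K_le[OF y eq[symmetric]] by linarith
    then have "x i = y i" for i
      using fun_cong[OF eq, of i] by (simp add: reflect_def split: if_splits)
    then show "x = y" ..
  qed
  moreover have "reflect ` ?W \<subseteq> inner_boundary a I t"
    using reflect_mem by blast
  ultimately show ?thesis
    using I by (intro card_inj_on_le[of reflect]) auto
qed

section \<open>The lower bound\<close>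

text \<open>
  The window from \<open>t\<close> to \<open>s = t + \<alpha>\<close> has at most twice the mass of the boundary. If it carries half of
  the halfspace, this suffices. Otherwise half of the halfspace lies above \<open>s\<close>, where the ramp
  equals 1, and the boundary has measure at least \<open>\<alpha> s p / 8\<close>. That is enough if \<open>\<alpha> s\<close> is bounded below;
  if not, the reverse Chernoff bound applies at \<open>s\<close> and shows that \<open>sqrt (ln (1 / p)) \<le> 8 s\<close>. It
  needs \<open>s \<ge> 1/2\<close>: for smaller \<open>s\<close> the level \<open>1/2\<close> takes the place of \<open>s\<close>, both in bounding the mean of
  \<open>X\<close> times the ramp and in bounding \<open>p\<close> from below.
\<close>

lemma card_inner_boundary_ge_of_nonneg:
  assumes I: "finite I" and a: "\<And>i. i \<in> I \<Longrightarrow> 0 \<le> a i \<and> a i \<le> \<alpha>"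
    and m: "m \<in> I" "a m = \<alpha>" and unit: "(\<Sum>i\<in>I. (a i)\<^sup>2) = 1" and "0 \<le> t"
    and p: "p * 2 ^ card I = real (card {x \<in> signs I. t < rad a I x})" "0 < p" "p \<le> 1 / 2"
  shows "exp (- 16) / 72 * (p * min 1 (\<alpha> * sqrt (ln (1 / p)))) * 2 ^ card I
    \<le> real (card (inner_boundary a I t))"
proof -
  define N where "N = (2 ^ card I :: real)"
  define s where "s = t + \<alpha>"
  \<comment> \<open>The factor \<open>exp (- 16)\<close> is the reverse Chernoff bound at level \<open>1 / 2\<close>; 72 is 8 times 9, with \<open>1 / 9\<close>
    the threshold for \<open>\<alpha> * s\<close> below.\<close>
  define c where "c = (exp (- 16) / 72 :: real)"
  let ?B = "inner_boundary a I t"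
  let ?W = "{x \<in> signs I. t < rad a I x \<and> rad a I x \<le> s}"
  let ?S = "\<Sum>x\<in>signs I. rad a I x * max 0 (min 1 ((rad a I x - t) / \<alpha>))"
  define M where "M = min 1 (\<alpha> * sqrt (ln (1 / p)))"
  have "0 < N"
    by (simp add: N_def)
  have c: "0 < c" "c \<le> 1 / 72"
    by (auto simp: c_def)
  have "\<alpha> \<noteq> 0"
  proof
    assume "\<alpha> = 0"
    then have "a i = 0" if "i \<in> I" for i
      using a[OF that] by simp
    then show False
      using unit by simp
  qed
  then have \<alpha>: "0 < \<alpha>"
    using a[OF m(1)] by simp
  have ln_p: "0 \<le> ln (1 / p)"
    using p by simp
  have M: "M \<le> 1" "M \<le> \<alpha> * sqrt (ln (1 / p))" "0 \<le> M"
    using \<alpha> ln_p by (auto simp: M_def)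
  have "?B \<union> ?W \<subseteq> ?B \<union> (?W - ?B)"
    by auto
  then have "card (?B \<union> ?W) \<le> card (?B \<union> (?W - ?B))"
    using I by (intro card_mono) auto
  also have "\<dots> \<le> card ?B + card (?W - ?B)"
    by (rule card_Un_le)
  also have "\<dots> \<le> 2 * card ?B"
    using card_window_diff_inner_boundary_le[OF I, of a m t] a m \<alpha> \<open>0 \<le> t\<close> by (simp add: s_def)
  finally have union_le: "real (card (?B \<union> ?W)) \<le> 2 * real (card ?B)"
    by linarith
  have ramp: "\<alpha> * ?S \<le> 4 * real (card ?B)"
    using sum_rad_ramp_le[OF I, of a \<alpha> t] a \<alpha> unit union_le by (simp add: s_def)
  have S_ge: "r * real (card {x \<in> signs I. r < rad a I x}) \<le> ?S" if "s \<le> r" for r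
  proof -
    have "r * real (card {x \<in> signs I. r < rad a I x}) = (\<Sum>x\<in>signs I. if r < rad a I x then r else 0)"
      using I by (simp add: sum.If_cases Int_def)
    also have "\<dots> \<le> ?S"
    proof (rule sum_mono)
      fix x
      define u where "u = rad a I x"
      have "(if r < u then r else 0) \<le> u * max 0 (min 1 ((u - t) / \<alpha>))"
      proof (cases "t < u")
        case True
        then have "0 \<le> u * max 0 (min 1 ((u - t) / \<alpha>))"
          using \<open>0 \<le> t\<close> by simp
        moreover have "max 0 (min 1 ((u - t) / \<alpha>)) = 1" if "r < u"
          using that \<open>s \<le> r\<close> \<alpha> by (simp add: s_def min_def)
        ultimately show ?thesis
          by auto
      next
        case False
        then have "(u - t) / \<alpha> \<le> 0"
          using \<alpha> by (simp add: divide_nonpos_pos)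
        then have "max 0 (min 1 ((u - t) / \<alpha>)) = 0"
          by linarith
        then show ?thesis
          using False that \<alpha> by (simp add: s_def)
      qed
      then show "(if r < rad a I x then r else 0)
          \<le> rad a I x * max 0 (min 1 ((rad a I x - t) / \<alpha>))"
        by (simp add: u_def)
    qed
    finally show ?thesis .
  qed
  have large_dev: "exp (- 64 * r\<^sup>2) * N \<le> real (card {x \<in> signs I. r < rad a I x})"
    if "1 / 2 \<le> r" "32 * (\<alpha> * r)\<^sup>2 \<le> 1" for r
    unfolding N_def using a that by (intro card_rad_gt_ge_exp[OF I _ unit]) auto
  have sqrt_le: "sqrt (ln (1 / p)) \<le> 8 * r"
    if r: "1 / 2 \<le> r" "32 * (\<alpha> * r)\<^sup>2 \<le> 1" "s \<le> r" for r
  proof -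
    have "exp (- 64 * r\<^sup>2) * N \<le> real (card {x \<in> signs I. r < rad a I x})"
      using r by (intro large_dev)
    also have "\<dots> \<le> real (card {x \<in> signs I. t < rad a I x})"
      using I r \<alpha> by (intro of_nat_mono card_mono) (auto simp: s_def)
    also have "\<dots> = p * N"
      using p(1) by (simp add: N_def)
    finally have "exp (- 64 * r\<^sup>2) \<le> p"
      using \<open>0 < N\<close> by simp
    then have "- 64 * r\<^sup>2 \<le> ln p"
      using p(2) by (simp add: ln_ge_iff)
    then have "ln (1 / p) \<le> (8 * r)\<^sup>2"
      using p(2) by (simp add: ln_div power_mult_distrib)
    then show ?thesis
      using r(1) by (intro real_le_lsqrt) auto
  qed
  have "c * (p * M) * N \<le> real (card ?B)"
  proof (cases "p * N \<le> 2 * real (card ?W)")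
    case True
    have "c * (p * M) \<le> 1 / 72 * (p * 1)"
      using c M p by (intro mult_mono) auto
    then have "c * (p * M) * N \<le> 1 / 72 * (p * 1) * N"
      using \<open>0 < N\<close> by (intro mult_right_mono) auto
    moreover have "real (card ?W) \<le> real (card (?B \<union> ?W))"
      using I by (intro of_nat_mono card_mono) auto
    moreover have "0 \<le> p * N"
      using p \<open>0 < N\<close> by simp
    ultimately show ?thesis
      using True union_le by simp
  next
    case False
    have "card {x \<in> signs I. t < rad a I x} \<le> card (?W \<union> {x \<in> signs I. s < rad a I x})"
      using I by (intro card_mono) auto
    also have "\<dots> \<le> card ?W + card {x \<in> signs I. s < rad a I x}"
      by (rule card_Un_le)
    finally have "p * N / 2 \<le> real (card {x \<in> signs I. s < rad a I x})"
      using False p(1) by (simp add: N_def)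
    then have "s * (p * N / 2) \<le> s * real (card {x \<in> signs I. s < rad a I x})"
      using \<open>0 \<le> t\<close> \<alpha> by (intro mult_left_mono) (auto simp: s_def)
    also have "\<dots> \<le> ?S"
      by (rule S_ge) simp
    finally have "\<alpha> * (s * (p * N / 2)) \<le> \<alpha> * ?S"
      using \<alpha> by (intro mult_left_mono) auto
    then have B_ge: "(\<alpha> * s) * (p * N) / 8 \<le> real (card ?B)"
      using ramp by (simp add: algebra_simps)
    \<comment> \<open>Below the threshold \<open>1 / 9\<close> both \<open>32 * (\<alpha> * s)\<^sup>2 \<le> 1\<close> and, because of \<open>\<alpha> \<le> s\<close>, also
      \<open>32 * (\<alpha> / 2)\<^sup>2 \<le> 1\<close> hold, as the reverse Chernoff bound requires.\<close>
    consider (big) "1 / 9 \<le> \<alpha> * s" | (tail) "\<alpha> * s < 1 / 9" "1 / 2 \<le> s"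
      | (centre) "\<alpha> * s < 1 / 9" "s < 1 / 2"
      by linarith
    then show ?thesis
    proof cases
      case big
      have "c * (p * M) * N \<le> 1 / 72 * (p * 1) * N"
        using c M p \<open>0 < N\<close> by (intro mult_mono) auto
      also have "\<dots> = 1 / 9 * (p * N) / 8"
        by simp
      also have "\<dots> \<le> (\<alpha> * s) * (p * N) / 8"
        using big p \<open>0 < N\<close> by (intro divide_right_mono mult_right_mono) auto
      finally show ?thesis
        using B_ge by linarith
    next
      case tail
      have "0 \<le> \<alpha> * s"
        using \<alpha> tail by simp
      then have "(\<alpha> * s)\<^sup>2 \<le> (1 / 9)\<^sup>2"
        using tail by (intro power_mono) auto
      then have "32 * (\<alpha> * s)\<^sup>2 \<le> 1"
        by (simp add: power_divide)
      then have "sqrt (ln (1 / p)) \<le> 8 * s"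
        using tail by (intro sqrt_le) auto
      then have "M \<le> \<alpha> * (8 * s)"
        using M(2) \<alpha> by (meson mult_left_mono less_imp_le order_trans)
      then have "c * (p * M) * N \<le> 1 / 72 * (p * (\<alpha> * (8 * s))) * N"
        using c M p \<alpha> tail \<open>0 < N\<close> by (intro mult_mono mult_nonneg_nonneg) auto
      also have "\<dots> = (\<alpha> * s) * (p * N) / 9"
        by simp
      also have "\<dots> \<le> (\<alpha> * s) * (p * N) / 8"
        using \<open>0 \<le> \<alpha> * s\<close> p \<open>0 < N\<close> by (intro divide_left_mono) auto
      finally show ?thesis
        using B_ge by linarith
    next
      case centre
      have "\<alpha> \<le> s"
        using \<open>0 \<le> t\<close> by (simp add: s_def)
      then have "\<alpha> * \<alpha> \<le> \<alpha> * s"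
        using \<alpha> by (intro mult_left_mono) auto
      then have "\<alpha>\<^sup>2 < 1 / 9"
        using centre by (simp add: power2_eq_square)
      then have half: "32 * (\<alpha> * (1 / 2))\<^sup>2 \<le> 1"
        by (simp add: power_mult_distrib power_divide)
      have "exp (- 16) * N \<le> real (card {x \<in> signs I. 1 / 2 < rad a I x})"
        using large_dev[of "1 / 2"] half by (simp add: power_divide)
      then have "1 / 2 * (exp (- 16) * N) \<le> ?S"
        using S_ge[of "1 / 2"] centre by simp
      then have "\<alpha> * (1 / 2 * (exp (- 16) * N)) \<le> \<alpha> * ?S"
        using \<alpha> by (intro mult_left_mono) auto
      then have ge: "\<alpha> * (exp (- 16) * N) / 8 \<le> real (card ?B)"
        using ramp by simp
      have "sqrt (ln (1 / p)) \<le> 8 * (1 / 2)"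
        using half centre by (intro sqrt_le) auto
      then have "\<alpha> * sqrt (ln (1 / p)) \<le> \<alpha> * 4"
        using \<alpha> by (intro mult_left_mono) auto
      then have "M \<le> \<alpha> * 4"
        using M(2) by linarith
      then have "c * (p * M) * N \<le> c * (1 / 2 * (\<alpha> * 4)) * N"
        using c M p \<open>0 < N\<close> by (intro mult_mono) auto
      also have "\<dots> = \<alpha> * (exp (- 16) * N) / 36"
        by (simp add: c_def)
      also have "\<dots> \<le> \<alpha> * (exp (- 16) * N) / 8"
        using \<alpha> \<open>0 < N\<close> by (intro divide_left_mono) auto
      finally show ?thesis
        using ge by linarith
    qed
  qed
  then show ?thesis
    by (simp add: c_def M_def N_def)
qed

text \<open>
  By symmetry at least half of all sign vectors have a nonnegative sum. So a halfspace with
  negative threshold and measure at most \<open>1/2\<close> consists of exactly these, and the sum never vanishes.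
\<close>

lemma signs_rad_gt_iff_of_neg:
  assumes I: "finite I" and "t < 0"
    and le: "2 * card {x \<in> signs I. t < rad a I x} \<le> 2 ^ card I" and x: "x \<in> signs I"
  shows "t < rad a I x \<longleftrightarrow> 0 < rad a I x"
proof -
  let ?P = "{x \<in> signs I. 0 \<le> rad a I x}" and ?M = "{x \<in> signs I. 0 \<le> - rad a I x}"
  have "card ?P = card ?M"
    using card_signs_uminus[of I "\<lambda>y. 0 \<le> y" a] by simp
  have "?P \<union> ?M = signs I"
    by auto
  then have total: "card ?P + card ?M = 2 ^ card I + card (?P \<inter> ?M)"
    using card_Un_Int[of ?P ?M] I by (simp add: card_signs)
  have sub: "?P \<subseteq> {x \<in> signs I. t < rad a I x}"
    using \<open>t < 0\<close> by auto
  have "card ?P \<le> card {x \<in> signs I. t < rad a I x}"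
    using sub I by (intro card_mono) auto
  then have "card ?P = card {x \<in> signs I. t < rad a I x}" "card (?P \<inter> ?M) = 0"
    using total le \<open>card ?P = card ?M\<close> by linarith+
  then have eq: "?P = {x \<in> signs I. t < rad a I x}" and disj: "?P \<inter> ?M = {}"
    using card_subset_eq[OF _ sub] I by auto
  have "x \<in> ?P \<longleftrightarrow> x \<in> {x \<in> signs I. t < rad a I x}"
    by (simp only: eq)
  moreover have "x \<notin> ?P \<inter> ?M"
    unfolding disj by simp
  ultimately show ?thesis
    using x by auto
qed

lemma card_inner_boundary_ge:
  assumes I: "finite I" and a: "\<And>i. i \<in> I \<Longrightarrow> 0 \<le> a i \<and> a i \<le> \<alpha>"
    and m: "m \<in> I" "a m = \<alpha>" and unit: "(\<Sum>i\<in>I. (a i)\<^sup>2) = 1"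
    and p: "p * 2 ^ card I = real (card {x \<in> signs I. t < rad a I x})" "0 < p" "p \<le> 1 / 2"
  shows "exp (- 16) / 72 * (p * min 1 (\<alpha> * sqrt (ln (1 / p)))) * 2 ^ card I
    \<le> real (card (inner_boundary a I t))"
proof (cases "0 \<le> t")
  case True
  then show ?thesis
    using assms by (intro card_inner_boundary_ge_of_nonneg)
next
  case False
  have "real (2 * card {x \<in> signs I. t < rad a I x}) = 2 * p * 2 ^ card I"
    using p(1) by simp
  also have "\<dots> \<le> 1 * 2 ^ card I"
    using p by (intro mult_right_mono) auto
  also have "\<dots> = real (2 ^ card I)"
    by simp
  finally have "2 * card {x \<in> signs I. t < rad a I x} \<le> 2 ^ card I"
    by (simp only: of_nat_le_iff)
  then have iff: "t < rad a I x \<longleftrightarrow> 0 < rad a I x" if "x \<in> signs I" for x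
    using that False I by (intro signs_rad_gt_iff_of_neg) auto
  have "{x \<in> signs I. t < rad a I x} = {x \<in> signs I. 0 < rad a I x}"
    using iff by auto
  moreover have "inner_boundary a I t = inner_boundary a I 0"
    unfolding inner_boundary_def using iff iff[OF flip_in_signs] by (auto simp flip: not_less)
  ultimately show ?thesis
    using assms by (simp only:) (intro card_inner_boundary_ge_of_nonneg[OF I a m unit], auto)
qed

section \<open>The vertex boundary of a halfspace\<close>

theorem theorem1p5:
  "\<exists>c1 c2 :: real. c1 > 0 \<and> c2 > 0 \<and>
    (\<forall>(n::nat) (t::real) (a :: nat \<Rightarrow> real).
      n \<ge> 1 \<longrightarrow>
      (\<forall>i\<in>{1..n}. \<forall>j\<in>{1..n}. i \<le> j \<longrightarrow> a j \<le> a i) \<longrightarrow>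
      (\<forall>i\<in>{1..n}. 0 \<le> a i) \<longrightarrow>
      (\<Sum>i=1..n. (a i)\<^sup>2) = 1 \<longrightarrow>
      (let f = halfspace n a t; p = cube_expectation n f in
        p \<le> 1 / 2 \<longrightarrow>
          c1 * boundary_bound (a 1) p \<le> real (card (vertex_boundary n f)) / 2 ^ n \<and>
          real (card (vertex_boundary n f)) / 2 ^ n \<le> c2 * boundary_bound (a 1) p))"
proof (rule exI[of _ "exp (- 16) / 72"], rule exI[of _ 32], intro conjI allI impI)
  fix n :: nat and t :: real and a :: "nat \<Rightarrow> real"
  assume n: "n \<ge> 1" and mono: "\<forall>i\<in>{1..n}. \<forall>j\<in>{1..n}. i \<le> j \<longrightarrow> a j \<le> a i"
    and nonneg: "\<forall>i\<in>{1..n}. 0 \<le> a i" and unit: "(\<Sum>i=1..n. (a i)\<^sup>2) = 1"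
  define I where "I = {1..n}"
  have I: "finite I" "card I = n" "1 \<in> I"
    using n by (auto simp: I_def)
  have a: "0 \<le> a i \<and> a i \<le> a 1" if "i \<in> I" for i
    using that n mono nonneg by (auto simp: I_def)
  have unit: "(\<Sum>i\<in>I. (a i)\<^sup>2) = 1"
    using unit by (simp add: I_def)
  have "a 1 \<noteq> 0"
  proof
    assume "a 1 = 0"
    then have "a i = 0" if "i \<in> I" for i
      using a[OF that] by simp
    then show False
      using unit by simp
  qed
  then have "0 < a 1"
    using a[OF I(3)] by simp
  define A where "A = {x \<in> signs I. t < rad a I x}"
  define B where "B = inner_boundary a I t"
  define p where "p = cube_expectation n (halfspace n a t)"
  have p: "p * 2 ^ card I = real (card A)"
    using I by (simp add: p_def A_def I_def cube_expectation_eq_average cube_def halfspace_def of_bool_def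
        sum.If_cases Int_def)
  have B: "vertex_boundary n (halfspace n a t) = B"
    by (auto simp: vertex_boundary_def B_def inner_boundary_def cube_def halfspace_def I_def not_less)
  have "B \<subseteq> A"
    by (auto simp: A_def B_def inner_boundary_def)
  then have B_le_A: "real (card B) \<le> p * 2 ^ card I"
    unfolding p using I by (intro of_nat_mono card_mono) (auto simp: A_def)
  have "0 \<le> p"
    by (simp add: p_def cube_expectation_eq_average halfspace_def sum_nonneg)
  have "exp (- 16) / 72 * boundary_bound (a 1) p \<le> real (card B) / 2 ^ n
      \<and> real (card B) / 2 ^ n \<le> 32 * boundary_bound (a 1) p" if "p \<le> 1 / 2"
  proof (cases "p = 0")
    case True
    then show ?thesis
      using B_le_A by (simp add: boundary_bound_def)
  next
    case False
    then have "0 < p"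
      using \<open>0 \<le> p\<close> by simp
    have "real (card B) \<le> real (card {x \<in> signs I. t < rad a I x \<and> rad a I x \<le> t + 2 * a 1})"
      unfolding B_def using I a by (intro of_nat_mono card_mono inner_boundary_subset_window) auto
    also have "\<dots> \<le> 32 * (p * (a 1 * sqrt (ln (1 / p)))) * 2 ^ card I"
      using card_window_le[OF I(1) a \<open>0 < a 1\<close> unit p[unfolded A_def] \<open>0 < p\<close> that] by simp
    finally have "real (card B) / 2 ^ n \<le> 32 * (p * (a 1 * sqrt (ln (1 / p))))"
      by (simp add: I divide_le_eq)
    moreover have "real (card B) / 2 ^ n \<le> 32 * (p * 1)"
      using B_le_A \<open>0 < p\<close> by (simp add: I divide_le_eq)
    ultimately have "real (card B) / 2 ^ n \<le> 32 * boundary_bound (a 1) p"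
      unfolding boundary_bound_def by (simp only: min_def split: if_split) simp
    moreover have "exp (- 16) / 72 * boundary_bound (a 1) p * 2 ^ card I \<le> real (card B)"
      unfolding boundary_bound_def B_def
      using card_inner_boundary_ge[OF I(1) a I(3) refl unit p[unfolded A_def] \<open>0 < p\<close> that] by simp
    ultimately show ?thesis
      by (simp add: I le_divide_eq)
  qed
  then show "let f = halfspace n a t; p = cube_expectation n f in
        p \<le> 1 / 2 \<longrightarrow>
          exp (- 16) / 72 * boundary_bound (a 1) p \<le> real (card (vertex_boundary n f)) / 2 ^ n \<and>
          real (card (vertex_boundary n f)) / 2 ^ n \<le> 32 * boundary_bound (a 1) p"
    by (simp add: Let_def p_def[symmetric] B)
qed auto

end
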